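(* Let $\alpha=a_p,a_{p-1},\ldots,a_1$ and $\beta=b_1,b_2,\ldots,b_n$ be non-empty finite sequences of positive integers, and let $G=\alpha\circledcirc\beta=a_p\ldots a_1\circledcirc b_1\ldots b_n$ be a mis\`ere \textsc{cricket pitch} position which is reduced, i.e. $a_p$ and $b_n$ are even. Index both sides from the roller outward, so that $\alpha$ is regarded as the sequence $(a_1,a_2,\ldots,a_p)$ and $\beta$ as $(b_1,\ldots,b_n)$. For a sequence $\gamma=(c_1,\ldots,c_s)$ of positive integers let $m(\gamma)=\max\{i: c_i \text{ is odd and } c_i\le c_j \text{ for all } j<i\}$ and $M(\gamma)=c_{m(\gamma)}$ if this set is non-empty, and $m(\gamma)=M(\gamma)=\infty$ otherwise. Then: \begin{enumerate} \item if $M(\alpha)<M(\beta)$ then $o(G)=\mathcal{L}$; \item if $M(\alpha)>M(\beta)$ then $o(G)=\mathcal{R}$; \item if $M(\alpha)=M(\beta)<\infty$ then $o(G)=\mathcal{N}$; \item if $M(\alpha)=M(\beta)=\infty$ then $o(G)=\mathcal{P}$. \end{enumerate}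
   Context: \textsc{cricket pitch}: a position is a finite row of bumps (non-negative integers) with one roller placed between two bumps or at one end; it is written $a_m\ldots a_1\circledcirc b_1\ldots b_n$, where $\circledcirc$ is the roller, so $a_1$ and $b_1$ are the bumps adjacent to the roller. Left moves the roller to the left over any positive number of consecutive bumps; Right moves it to the right over any positive number of consecutive bumps. Each bump rolled over is reduced by $1$. A bump of value $0$ is no longer a bump and can no longer be rolled over. Mis\`ere play: the player who cannot move on their turn wins. Outcome classes: $\mathcal{L}$ (Left wins whoever moves first), $\mathcal{R}$ (Right wins whoever moves first), $\mathcal{N}$ (the player moving first wins), $\mathcal{P}$ (the player moving second wins). *)

theory Defs
  imports Main "HOL-Library.Extended_Nat"
begin

datatype player = Left | Right

fun opponent :: "player \<Rightarrow> player" where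
  "opponent Left = Right"
| "opponent Right = Left"

text \<open>
  The pair \<open>(\<alpha>, \<beta>)\<close> is the row with the roller between \<open>\<alpha>\<close> and \<open>\<beta>\<close>.  Both lists are read
  from the roller outward, so \<open>\<alpha>\<close> lists the left-hand side from right to left, and the head of
  each list is the bump adjacent to the roller.
\<close>
type_synonym position = "nat list \<times> nat list"

text \<open>
  Bumps that are rolled over end up on the other side of the roller, the last one rolled over
  being adjacent to it; hence the reversal.  A flattened bump stays in the list as an entry
  \<open>0\<close>, which blocks the roller for the rest of the game.
\<close>
fun moves :: "player \<Rightarrow> position \<Rightarrow> position set" where
  "moves Left (\<alpha>, \<beta>) =
     {(drop k \<alpha>, rev (map (\<lambda>x. x - 1) (take k \<alpha>)) @ \<beta>) | k.
        1 \<le> k \<and> k \<le> length \<alpha> \<and> (\<forall>a \<in> set (take k \<alpha>). 0 < a)}"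
| "moves Right (\<alpha>, \<beta>) =
     {(rev (map (\<lambda>x. x - 1) (take k \<beta>)) @ \<alpha>, drop k \<beta>) | k.
        1 \<le> k \<and> k \<le> length \<beta> \<and> (\<forall>b \<in> set (take k \<beta>). 0 < b)}"

fun total :: "position \<Rightarrow> nat" where
  "total (\<alpha>, \<beta>) = sum_list \<alpha> + sum_list \<beta>"

lemma sum_list_decr_less:
  fixes xs :: "nat list"
  assumes "xs \<noteq> []" "\<forall>x \<in> set xs. 0 < x"
  shows "sum_list (map (\<lambda>x. x - 1) xs) < sum_list xs"
  using assms
proof (induction xs)
  case (Cons x xs)
  then show ?case by (cases "xs = []") (auto intro: add_less_le_mono)
qed simp

lemma roll_decreases:
  fixes xs :: "nat list"
  assumes "1 \<le> k" "k \<le> length xs" "\<forall>x \<in> set (take k xs). 0 < x"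
  shows "sum_list (drop k xs) + sum_list (map (\<lambda>x. x - 1) (take k xs)) < sum_list xs"
proof -
  have "take k xs \<noteq> []" using assms(1,2) by auto
  then have "sum_list (map (\<lambda>x. x - 1) (take k xs)) < sum_list (take k xs)"
    using assms(3) by (rule sum_list_decr_less)
  moreover have "sum_list (take k xs) + sum_list (drop k xs) = sum_list xs"
    by (metis append_take_drop_id sum_list_append)
  ultimately show ?thesis by linarith
qed

lemma moves_total: "H \<in> moves p G \<Longrightarrow> total H < total G"
proof -
  assume H: "H \<in> moves p G"
  obtain \<alpha> \<beta> where G: "G = (\<alpha>, \<beta>)" by (cases G)
  show "total H < total G"
  proof (cases p)
    case Left
    then obtain k where k: "1 \<le> k" "k \<le> length \<alpha>" "\<forall>a \<in> set (take k \<alpha>). 0 < a"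
      and H': "H = (drop k \<alpha>, rev (map (\<lambda>x. x - 1) (take k \<alpha>)) @ \<beta>)"
      using H G by auto
    show ?thesis using roll_decreases[OF k] by (simp add: G H' sum_list_rev)
  next
    case Right
    then obtain k where k: "1 \<le> k" "k \<le> length \<beta>" "\<forall>b \<in> set (take k \<beta>). 0 < b"
      and H': "H = (rev (map (\<lambda>x. x - 1) (take k \<beta>)) @ \<alpha>, drop k \<beta>)"
      using H G by auto
    show ?thesis using roll_decreases[OF k] by (simp add: G H' sum_list_rev)
  qed
qed

text \<open>
  \<open>wins_first p G\<close>: player \<open>p\<close>, moving first from \<open>G\<close>, wins under misere play.
\<close>
function wins_first :: "player \<Rightarrow> position \<Rightarrow> bool" where
  "wins_first p G \<longleftrightarrow> moves p G = {} \<or> (\<exists>H \<in> moves p G. \<not> wins_first (opponent p) H)"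
  by pat_completeness auto
termination
  by (relation "measure (\<lambda>(p, G). total G)") (auto dest: moves_total)

declare wins_first.simps [simp del]

text \<open>The player who wins \<open>G\<close> when \<open>p\<close> moves first; play always ends and there are no draws.\<close>
definition winner :: "player \<Rightarrow> position \<Rightarrow> player" where
  "winner p G = (if wins_first p G then p else opponent p)"

datatype outcome_class = \<L> | \<R> | \<N> | \<P>

definition outcome :: "position \<Rightarrow> outcome_class" where
  "outcome G =
     (if \<forall>p. winner p G = Left then \<L>
      else if \<forall>p. winner p G = Right then \<R>
      else if \<forall>p. winner p G = p then \<N>
      else \<P>)"

lemma all_player: "(\<forall>p. Q p) \<longleftrightarrow> Q Left \<and> Q Right"
  by (metis player.exhaust)

lemma outcome_iff:
  "outcome G = \<L> \<longleftrightarrow> (\<forall>p. winner p G = Left)"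
  "outcome G = \<R> \<longleftrightarrow> (\<forall>p. winner p G = Right)"
  "outcome G = \<N> \<longleftrightarrow> (\<forall>p. winner p G = p)"
  "outcome G = \<P> \<longleftrightarrow> (\<forall>p. winner p G = opponent p)"
  unfolding outcome_def all_player
  by (cases "winner Left G"; cases "winner Right G"; simp)+

text \<open>The index \<open>i\<close> is 1-based: the term \<open>c\<^sub>i\<close> of the sequence is \<open>\<gamma> ! (i - 1)\<close>.\<close>
definition odd_min_indices :: "nat list \<Rightarrow> nat set" where
  "odd_min_indices \<gamma> =
     {i. 1 \<le> i \<and> i \<le> length \<gamma> \<and> odd (\<gamma> ! (i - 1)) \<and>
         (\<forall>j. 1 \<le> j \<and> j < i \<longrightarrow> \<gamma> ! (i - 1) \<le> \<gamma> ! (j - 1))}"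

definition m :: "nat list \<Rightarrow> enat" where
  "m \<gamma> = (if odd_min_indices \<gamma> = {} then \<infinity> else enat (Max (odd_min_indices \<gamma>)))"

definition M :: "nat list \<Rightarrow> enat" where
  "M \<gamma> = (case m \<gamma> of enat i \<Rightarrow> enat (\<gamma> ! (i - 1)) | \<infinity> \<Rightarrow> \<infinity>)"

end

theory Submission
  imports Defs
begin

text \<open>
  Cut each side of the row at its first \<open>0\<close>.  A side then matters only through one of four kinds
  of value: \<open>Blocked\<close> if it is empty; \<open>Stuck\<close> if all its bumps are odd, in which case its owner loses
  when moving first; otherwise, after deleting the odd bumps at the outer end, \<open>Finite v\<close> for the
  smallest odd prefix minimum \<open>v\<close>, or \<open>Infinite\<close> if there is none.  The value can be computed by
  adding bumps at the roller one at a time, and a roll over \<open>k\<close> bumps is \<open>k\<close> rolls over a single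
  bump.  So the rule \<open>beats\<close>, which tells from the two values whether the mover wins, only has to be
  verified for the roll over a single bump.
\<close>

section \<open>Values of sides and their behaviour under a roll\<close>

datatype side_value = Blocked | Finite nat | Infinite | Stuck

text \<open>\<open>Blocked\<close> and \<open>Stuck\<close> have the same rows because odd bumps at
  the outer end are deleted; the rows for \<open>Finite\<close> and \<open>Infinite\<close> follow
  the recursion \<open>M_Cons\<close>, except that a \<open>0\<close> blocks.\<close>

fun put :: "nat \<Rightarrow> side_value \<Rightarrow> side_value" where
  "put x Blocked = (if x = 0 then Blocked else if odd x then Stuck else Infinite)"
| "put x Stuck = (if x = 0 then Blocked else if odd x then Stuck else Infinite)"
| "put x (Finite v) =
     (if x = 0 then Blocked else if v \<le> x then Finite v else if odd x then Finite x else Infinite)"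
| "put x Infinite = (if x = 0 then Blocked else if odd x then Finite x else Infinite)"

definition side_value :: "nat list \<Rightarrow> side_value" where
  "side_value xs = foldr put xs Blocked"

lemma side_value_simps [simp]:
  "side_value [] = Blocked"
  "side_value (x # xs) = put x (side_value xs)"
  by (simp_all add: side_value_def)

text \<open>Oddness of \<open>v\<close> excludes the case \<open>s = Finite x\<close> with
  \<open>x\<close> even, in which \<open>beats_put_cases\<close> can fail.\<close>

definition admissible :: "side_value \<Rightarrow> bool" where
  "admissible s \<longleftrightarrow> (\<forall>v. s = Finite v \<longrightarrow> odd v)"

lemma admissible_simps [simp]:
  "admissible Blocked" "admissible Stuck" "admissible Infinite" "admissible (Finite v) \<longleftrightarrow> odd v"
  by (auto simp: admissible_def)

lemma admissible_put: "admissible s \<Longrightarrow> admissible (put x s)"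
  by (cases s) auto

lemma admissible_side_value: "admissible (side_value xs)"
  by (induction xs) (auto intro: admissible_put)

lemma put_eq_Blocked_iff: "put x s = Blocked \<longleftrightarrow> x = 0"
  by (cases s) auto

text \<open>The first argument belongs to the player to move. A blocked mover wins by the misere
  convention. A stuck mover leaves an even number next to the roller, so the opponent's new value
  beats the \<open>Blocked\<close> or \<open>Stuck\<close> remainder.\<close>

fun beats :: "side_value \<Rightarrow> side_value \<Rightarrow> bool" where
  "beats Blocked t \<longleftrightarrow> True"
| "beats Stuck t \<longleftrightarrow> False"
| "beats Infinite t \<longleftrightarrow> t = Blocked \<or> t = Stuck"
| "beats (Finite v) t \<longleftrightarrow> (case t of Finite u \<Rightarrow> v \<le> u | _ \<Rightarrow> True)"

text \<open>Here \<open>s\<close> and \<open>t\<close> stand for the values of \<open>a\<close> and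
  \<open>b\<close> when the mover has \<open>x # a\<close> against \<open>b\<close>. Stopping after
  one bump lets the opponent move with \<open>put (x - 1) t\<close> against
  \<open>s\<close>.\<close>

lemma beats_put_if_reply_fails:
  assumes "0 < x" "admissible s" "admissible t" "\<not> beats (put (x - 1) t) s"
  shows "beats (put x s) t"
  using assms
  by (cases s; cases t) (auto split: if_splits elim!: oddE evenE)

text \<open>The other option after one bump: the same player rolls on, with \<open>s\<close> against
  \<open>put (x - 1) t\<close>.\<close>

lemma beats_put_if_beats:
  assumes "0 < x" "admissible s" "admissible t" "s \<noteq> Blocked" "beats s (put (x - 1) t)"
  shows "beats (put x s) t"
  using assms
  by (cases s; cases t) (auto split: if_splits elim!: oddE evenE)

text \<open>Converse of the two preceding lemmas: a mover whose value wins can either stop after one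
  bump or roll on with a winning value.\<close>

lemma beats_put_cases:
  assumes "0 < x" "admissible s" "admissible t" "beats (put x s) t"
  shows "\<not> beats (put (x - 1) t) s \<or> s \<noteq> Blocked \<and> beats s (put (x - 1) t)"
  using assms
  by (cases s; cases t; auto split: if_splits elim!: oddE evenE; presburger)

text \<open>A winning move as judged by \<open>beats\<close> instead of \<open>wins_first\<close>;
  this allows induction on the bumps of \<open>a\<close>, apart from the recursion of the
  game.\<close>

definition good_roll :: "nat list \<Rightarrow> nat list \<Rightarrow> bool" where
  "good_roll a b \<longleftrightarrow> (\<exists>k. 1 \<le> k \<and> k \<le> length a \<and> (\<forall>x \<in> set (take k a). 0 < x) \<and>
     \<not> beats (side_value (rev (map (\<lambda>x. x - 1) (take k a)) @ b)) (side_value (drop k a)))"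

lemma good_roll_Nil: "\<not> good_roll [] b"
  by (simp add: good_roll_def)

text \<open>After the first bump the roller stands between \<open>a\<close> and
  \<open>(x - 1) # b\<close>; there the roll stops, or its remainder is itself a roll.\<close>

lemma good_roll_Cons:
  "good_roll (x # a) b \<longleftrightarrow>
     0 < x \<and> (\<not> beats (side_value ((x - 1) # b)) (side_value a) \<or> good_roll a ((x - 1) # b))"
  (is "?L \<longleftrightarrow> ?R")
proof
  assume ?L
  then obtain k where k: "1 \<le> k" "k \<le> length (x # a)" "\<forall>y \<in> set (take k (x # a)). 0 < y"
    "\<not> beats (side_value (rev (map (\<lambda>x. x - 1) (take k (x # a))) @ b)) (side_value (drop k (x # a)))"
    unfolding good_roll_def by blast
  then obtain j where j: "k = Suc j" by (cases k) auto
  show ?R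
  proof (cases "j = 0")
    case True
    with k j show ?thesis by simp
  next
    case False
    with k j have "good_roll a ((x - 1) # b)"
      unfolding good_roll_def by (intro exI[of _ j]) auto
    with k j show ?thesis by simp
  qed
next
  assume R: ?R
  show ?L
  proof (cases "good_roll a ((x - 1) # b)")
    case True
    then obtain j where "1 \<le> j" "j \<le> length a" "\<forall>y \<in> set (take j a). 0 < y"
      "\<not> beats (side_value (rev (map (\<lambda>x. x - 1) (take j a)) @ (x - 1) # b)) (side_value (drop j a))"
      unfolding good_roll_def by blast
    with R show ?thesis
      unfolding good_roll_def by (intro exI[of _ "Suc j"]) auto
  next
    case False
    with R show ?thesis
      unfolding good_roll_def by (intro exI[of _ 1]) auto
  qed
qed

lemma good_roll_iff:
  "good_roll a b \<longleftrightarrow> side_value a \<noteq> Blocked \<and> beats (side_value a) (side_value b)"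
proof (induction a arbitrary: b)
  case Nil
  then show ?case by (simp add: good_roll_Nil)
next
  case (Cons x a)
  show ?case
  proof (cases "x = 0")
    case True
    then show ?thesis by (simp add: good_roll_Cons put_eq_Blocked_iff)
  next
    case False
    note adm = admissible_side_value[of a] admissible_side_value[of b]
    \<comment> \<open>The induction hypothesis at \<open>(x - 1) # b\<close> turns rolling on into a
      statement about values; the three single-bump lemmas then give both directions.\<close>
    show ?thesis
      using False beats_put_if_reply_fails[OF _ adm, of x] beats_put_if_beats[OF _ adm, of x]
        beats_put_cases[OF _ adm, of x]
      by (auto simp: good_roll_Cons Cons.IH put_eq_Blocked_iff)
  qed
qed

section \<open>From values to the winner\<close>

lemma moves_Left_empty_iff: "moves Left (a, b) = {} \<longleftrightarrow> side_value a = Blocked"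
proof
  assume empty: "moves Left (a, b) = {}"
  show "side_value a = Blocked"
  proof (rule ccontr)
    assume "side_value a \<noteq> Blocked"
    then obtain x xs where "a = x # xs" "0 < x"
      by (cases a) (auto simp: put_eq_Blocked_iff)
    then have "(drop 1 a, rev (map (\<lambda>x. x - 1) (take 1 a)) @ b) \<in> moves Left (a, b)"
      by (auto intro!: exI[of _ 1])
    with empty show False by blast
  qed
next
  assume "side_value a = Blocked"
  then show "moves Left (a, b) = {}"
    by (cases a) (auto simp: put_eq_Blocked_iff take_Cons')
qed

lemma moves_Right_eq: "moves Right (b, a) = prod.swap ` moves Left (a, b)"
  by (auto simp: image_iff)

text \<open>Mirror symmetry, proved for both players at once since each reply belongs to the other
  player.\<close>

lemma wins_first_Right_eq: "wins_first Right (b, a) \<longleftrightarrow> wins_first Left (a, b)"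
proof -
  have "wins_first p G \<longleftrightarrow> wins_first (opponent p) (prod.swap G)" for p G
  proof (induction "total G" arbitrary: p G rule: less_induct)
    case less
    have opp: "opponent (opponent p) = p" by (cases p) auto
    have mv: "moves (opponent p) (prod.swap G) = prod.swap ` moves p G"
      by (cases p; cases G) (auto simp: moves_Right_eq image_image simp del: moves.simps)
    have "wins_first (opponent p) H \<longleftrightarrow> wins_first p (prod.swap H)" if "H \<in> moves p G" for H
      using less[OF moves_total[OF that], of "opponent p"] opp by simp
    then show ?case
      by (subst (1 2) wins_first.simps) (auto simp: mv opp)
  qed
  from this[of Right "(b, a)"] show ?thesis by simp
qed

lemma wins_first_Left_iff: "wins_first Left (a, b) \<longleftrightarrow> beats (side_value a) (side_value b)"
proof (induction "total (a, b)" arbitrary: a b rule: less_induct)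
  case less
  \<comment> \<open>Mirroring makes Right's side the mover's side, so the hypothesis is used at the
    swapped pair, which has the same total.\<close>
  have reply: "wins_first Right (a', b') \<longleftrightarrow> beats (side_value b') (side_value a')"
    if "(a', b') \<in> moves Left (a, b)" for a' b'
    using less[of b' a'] moves_total[OF that] by (simp add: wins_first_Right_eq add.commute)
  have "(\<exists>H \<in> moves Left (a, b). \<not> wins_first Right H) \<longleftrightarrow>
    (\<exists>(a', b') \<in> moves Left (a, b). \<not> beats (side_value b') (side_value a'))"
    using reply by (intro bex_cong refl) (auto simp del: moves.simps)
  also have "\<dots> \<longleftrightarrow> good_roll a b"
    by (auto simp: good_roll_def)
  finally show ?case
    by (subst wins_first.simps) (auto simp: moves_Left_empty_iff good_roll_iff simp del: moves.simps)
qed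

section \<open>Recursive computation of \<open>M\<close>\<close>

lemma finite_odd_min_indices: "finite (odd_min_indices \<gamma>)"
  by (rule finite_subset[of _ "{..length \<gamma>}"]) (auto simp: odd_min_indices_def)

text \<open>Entries at odd prefix minima weakly decrease outward, so the one with the largest index
  is the least; the empty infimum is \<infinity>.\<close>

lemma M_eq_INF: "M \<gamma> = (INF i \<in> odd_min_indices \<gamma>. enat (\<gamma> ! (i - 1)))"
proof (cases "odd_min_indices \<gamma> = {}")
  case True
  then show ?thesis by (simp add: M_def m_def top_enat_def)
next
  case False
  let ?i = "Max (odd_min_indices \<gamma>)"
  have i: "?i \<in> odd_min_indices \<gamma>"
    using False by (simp add: finite_odd_min_indices)
  have "\<gamma> ! (?i - 1) \<le> \<gamma> ! (j - 1)" if "j \<in> odd_min_indices \<gamma>" for j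
  proof (cases "j = ?i")
    case False
    with Max_ge[OF finite_odd_min_indices that] have "j < ?i" by simp
    with i that show ?thesis unfolding odd_min_indices_def by blast
  qed simp
  then have "(INF i \<in> odd_min_indices \<gamma>. enat (\<gamma> ! (i - 1))) = enat (\<gamma> ! (?i - 1))"
    using i by (intro antisym INF_lower INF_greatest) auto
  with False show ?thesis by (simp add: M_def m_def)
qed

lemma odd_min_indices_Cons:
  "odd_min_indices (x # \<gamma>) =
     (if odd x then {1} else {}) \<union> Suc ` {i \<in> odd_min_indices \<gamma>. \<gamma> ! (i - 1) \<le> x}"
  (is "?L = ?R")
proof (intro set_eqI)
  fix i
  consider "i = 0" | "i = 1" | j where "i = Suc j" "1 \<le> j"
    by (cases i rule: nat.exhaust; force)
  then show "i \<in> ?L \<longleftrightarrow> i \<in> ?R"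
  proof cases
    case 3
    have "(\<forall>k. 1 \<le> k \<and> k < Suc j \<longrightarrow> \<gamma> ! (j - 1) \<le> (x # \<gamma>) ! (k - 1)) \<longleftrightarrow>
      \<gamma> ! (j - 1) \<le> x \<and> (\<forall>k. 1 \<le> k \<and> k < j \<longrightarrow> \<gamma> ! (j - 1) \<le> \<gamma> ! (k - 1))"
      (is "?A \<longleftrightarrow> ?B")
    proof
      assume A: ?A
      have "\<gamma> ! (j - 1) \<le> \<gamma> ! (k - 1)" if "1 \<le> k" "k < j" for k
        using A[rule_format, of "Suc k"] that by (auto simp: nth_Cons split: nat.splits)
      then show ?B using A[rule_format, of 1] 3 by auto
    next
      assume ?B
      then have "\<gamma> ! (j - 1) \<le> (x # \<gamma>) ! (k - 1)" if "1 \<le> k" "k < Suc j" for k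
        using that by (cases "k = 1") (auto simp: nth_Cons' dest: spec[of _ "k - 1"])
      then show ?A by blast
    qed
    with 3 show ?thesis
      by (auto simp: odd_min_indices_def nth_Cons')
  qed (auto simp: odd_min_indices_def)
qed

lemma M_Cons:
  "M (x # \<gamma>) = (if M \<gamma> \<le> enat x then M \<gamma> else if odd x then enat x else \<infinity>)"
proof -
  let ?S = "{i \<in> odd_min_indices \<gamma>. \<gamma> ! (i - 1) \<le> x}"
  let ?I = "INF i \<in> ?S. enat (\<gamma> ! (i - 1))"
  have pos: "1 \<le> i" if "i \<in> odd_min_indices \<gamma>" for i
    using that by (simp add: odd_min_indices_def)
  \<comment> \<open>Shifting needs \<open>1 \<le> i\<close>: at \<open>i = 0\<close> the truncated
    \<open>i - 1\<close> would pick different entries.\<close>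
  have "(INF i \<in> Suc ` ?S. enat ((x # \<gamma>) ! (i - 1))) = ?I"
    unfolding image_image using pos by (intro INF_cong) (auto simp: nth_Cons')
  then have M: "M (x # \<gamma>) = (if odd x then inf (enat x) ?I else ?I)"
    by (simp add: M_eq_INF odd_min_indices_Cons image_Un Inf_union_distrib)
  show ?thesis
  proof (cases "M \<gamma> \<le> enat x")
    case True
    have "?I = M \<gamma>"
    proof (rule antisym)
      show "M \<gamma> \<le> ?I"
        unfolding M_eq_INF by (rule INF_superset_mono) auto
      have "?I \<le> enat (\<gamma> ! (i - 1))" if "i \<in> odd_min_indices \<gamma>" for i
      proof (cases "i \<in> ?S")
        case True
        then show ?thesis by (rule INF_lower)
      next
        case False
        \<comment> \<open>A discarded entry exceeds \<open>x\<close>, while the entry at the largest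
          index is at most \<open>x\<close> and survives.\<close>
        have ne: "odd_min_indices \<gamma> \<noteq> {}" using that by blast
        let ?k = "Max (odd_min_indices \<gamma>)"
        have "M \<gamma> = enat (\<gamma> ! (?k - 1))" by (simp add: M_def m_def ne)
        with \<open>M \<gamma> \<le> enat x\<close> have "?k \<in> ?S" "\<gamma> ! (?k - 1) \<le> x"
          using Max_in[OF finite_odd_min_indices ne] by auto
        then have "?I \<le> enat (\<gamma> ! (?k - 1))" by (intro INF_lower)
        also have "\<dots> \<le> enat (\<gamma> ! (i - 1))"
          using \<open>\<gamma> ! (?k - 1) \<le> x\<close> False that by auto
        finally show ?thesis .
      qed
      then show "?I \<le> M \<gamma>" unfolding M_eq_INF by (rule INF_greatest)
    qed
    with True M show ?thesis by (simp add: inf_absorb2)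
  next
    case False
    have "?S = {}"
    proof (rule ccontr)
      assume "?S \<noteq> {}"
      then obtain i where "i \<in> odd_min_indices \<gamma>" "\<gamma> ! (i - 1) \<le> x" by blast
      then have "M \<gamma> \<le> enat x"
        unfolding M_eq_INF by (intro INF_lower2) auto
      with False show False by blast
    qed
    with False M show ?thesis by (simp only: image_empty Inf_empty inf_top_right if_False top_enat_def[symmetric])
  qed
qed

lemma M_Nil: "M [] = \<infinity>"
  by (simp add: M_def m_def odd_min_indices_def)

text \<open>The even last bump starts the recursion at \<open>Infinite\<close>, and no
  \<open>0\<close> occurs, so \<open>put\<close> and \<open>M_Cons\<close> agree from there
  on.\<close>

lemma side_value_eq_M:
  assumes "\<gamma> \<noteq> []" "\<forall>c \<in> set \<gamma>. 0 < c" "even (last \<gamma>)"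
  shows "side_value \<gamma> = (case M \<gamma> of enat v \<Rightarrow> Finite v | \<infinity> \<Rightarrow> Infinite)"
  using assms
proof (induction \<gamma> rule: list_nonempty_induct)
  case (single x)
  then show ?case by (simp add: M_Cons M_Nil)
next
  case (cons x \<gamma>)
  then have "side_value \<gamma> = (case M \<gamma> of enat v \<Rightarrow> Finite v | \<infinity> \<Rightarrow> Infinite)" "0 < x"
    by auto
  then show ?case by (cases "M \<gamma>") (auto simp: M_Cons)
qed

theorem theorem6:
  fixes \<alpha> \<beta> :: "nat list" and G :: position
  assumes "\<alpha> \<noteq> []" and "\<beta> \<noteq> []"
    and "\<forall>a \<in> set \<alpha>. 0 < a" and "\<forall>b \<in> set \<beta>. 0 < b"
    and "G = (\<alpha>, \<beta>)"
    and "even (last \<alpha>)" and "even (last \<beta>)"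
  shows "(M \<alpha> < M \<beta> \<longrightarrow> outcome G = \<L>) \<and>
         (M \<alpha> > M \<beta> \<longrightarrow> outcome G = \<R>) \<and>
         (M \<alpha> = M \<beta> \<and> M \<beta> < \<infinity> \<longrightarrow> outcome G = \<N>) \<and>
         (M \<alpha> = M \<beta> \<and> M \<beta> = \<infinity> \<longrightarrow> outcome G = \<P>)"
proof -
  \<comment> \<open>Neither side is \<open>Blocked\<close> or \<open>Stuck\<close>, so a mover with
    value \<open>Infinite\<close> loses; hence the condition
    \<open>M \<alpha> < \<infinity>\<close>.\<close>
  have Left: "wins_first Left G \<longleftrightarrow> M \<alpha> \<le> M \<beta> \<and> M \<alpha> < \<infinity>"
    using assms
    by (cases "M \<alpha>"; cases "M \<beta>") (simp_all add: wins_first_Left_iff side_value_eq_M)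
  have Right: "wins_first Right G \<longleftrightarrow> M \<beta> \<le> M \<alpha> \<and> M \<beta> < \<infinity>"
    using assms
    by (cases "M \<alpha>"; cases "M \<beta>")
      (simp_all add: wins_first_Right_eq wins_first_Left_iff side_value_eq_M)
  show ?thesis
    unfolding outcome_iff all_player winner_def Left Right
    by (cases "M \<alpha>"; cases "M \<beta>") auto
qed

end
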